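(* Let $(X,\mu,\mathcal{E},\mathcal{F})$ be a Dirichlet space with conservative heat semigroup $\{P_t\}_{t\in[0,\infty)}$. Assume that $P_t$ admits a measurable heat kernel $p_t(x,y)$ satisfying, for some $C>0$ and $\beta>0$, $p_t(x,y)\le C t^{-\beta}$ for $\mu\times\mu$-a.e. $(x,y)\in X\times X$ and each $t\in(0,+\infty)$. Let $0<\alpha<\beta$ and $1\le p<\frac{\beta}{\alpha}$. Then there exists a constant $C_{p,\alpha,\beta}>0$ such that for every $f\in\mathbf{B}^{p,\alpha}(X)$, $$\sup_{s\ge0}\, s\,\mu\left(\{x\in X:|f(x)|\ge s\}\right)^{\frac1q}\le C_{p,\alpha,\beta}\|f\|_{p,\alpha},\qquad q=\frac{p\beta}{\beta-p\alpha}.$$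
   Context: $X$ is a good measurable space (the measure decomposition theorem holds and the $\sigma$-algebra is generated by a countable family; e.g. a Polish space) with a $\sigma$-finite measure $\mu$. A Dirichlet form is a densely defined closed symmetric form $(\mathcal{E},\mathcal{F})$ on $L^2(X,\mu)$ which is Markovian: if $u\in\mathcal F$ and $v$ satisfies $|v(x)-v(y)|\le|u(x)-u(y)|$ and $|v(x)|\le|u(x)|$ for a.e. $x,y$, then $v\in\mathcal F$ and $\mathcal E(v,v)\le\mathcal E(u,u)$. Then $(X,\mu,\mathcal E,\mathcal F)$ is called a Dirichlet space. $\{P_t\}_{t\ge0}$ is the associated self-adjoint sub-Markovian semigroup on $L^2(X,\mu)$ (the heat semigroup), extended to a contraction semigroup on every $L^p(X,\mu)$, $1\le p\le\infty$. It is conservative if $P_t1=1$ for all $t$. It admits a heat kernel if there is a measurable function $(t,x,y)\mapsto p_t(x,y)\ge0$ such that $P_tf(x)=\int_X p_t(x,y)f(y)\,d\mu(y)$ for all $t>0$ and $f\in L^p(X,\mu)$, $1\le p\le\infty$. For $p\ge1$, $\alpha\ge0$, $f\in L^p(X,\mu)$, $$\|f\|_{p,\alpha}=\sup_{t>0}t^{-\alpha}\left(\int_XP_t(|f-f(y)|^p)(y)\,d\mu(y)\right)^{1/p}=\sup_{t>0}t^{-\alpha}\left(\int_X\int_X|f(x)-f(y)|^pp_t(x,y)\,d\mu(x)\,d\mu(y)\right)^{1/p},$$ and $\mathbf B^{p,\alpha}(X)=\{f\in L^p(X,\mu):\|f\|_{p,\alpha}<+\infty\}$. *)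

theory Defs
  imports "HOL-Probability.Probability"
begin

section \<open>Lebesgue spaces\<close>

text \<open>Functions are not identified modulo null sets: elements of the Lebesgue spaces are
  measurable functions, and every notion below is invariant under almost everywhere equality.\<close>

text \<open>Real powers on \<open>[0,\<infinity>]\<close>, for exponents \<open>r > 0\<close>.\<close>

definition epowr :: "ennreal \<Rightarrow> real \<Rightarrow> ennreal" where
  "epowr a r = (if a = \<infinity> then \<infinity> else ennreal (enn2real a powr r))"

definition Lp_norm :: "'a measure \<Rightarrow> ennreal \<Rightarrow> ('a \<Rightarrow> real) \<Rightarrow> ennreal" where
  "Lp_norm M p f =
     (if p = \<infinity> then esssup M (\<lambda>x. ennreal \<bar>f x\<bar>)
      else epowr (\<integral>\<^sup>+x. ennreal (\<bar>f x\<bar> powr enn2real p) \<partial>M) (1 / enn2real p))"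

definition Lp :: "'a measure \<Rightarrow> ennreal \<Rightarrow> ('a \<Rightarrow> real) set" where
  "Lp M p = {f \<in> borel_measurable M. Lp_norm M p f < \<infinity>}"

definition L2_inner :: "'a measure \<Rightarrow> ('a \<Rightarrow> real) \<Rightarrow> ('a \<Rightarrow> real) \<Rightarrow> real" where
  "L2_inner M f g = (\<integral>x. f x * g x \<partial>M)"

section \<open>Good measurable spaces\<close>

text \<open>Only the measurable structure of \<open>M\<close> matters here. The measure decomposition theorem is
  said to hold if every probability measure \<open>\<nu>\<close> on the product space disintegrates as
  \<open>\<nu>(dx,dy) = k(x,dy) \<nu>\<^sub>1(dx)\<close>, with \<open>k\<close> a Markov kernel and \<open>\<nu>\<^sub>1\<close> the first marginal of \<open>\<nu>\<close>.\<close>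

definition measure_decomposition :: "'a measure \<Rightarrow> bool" where
  "measure_decomposition M \<longleftrightarrow>
     (\<forall>\<nu>. prob_space \<nu> \<and> sets \<nu> = sets (M \<Otimes>\<^sub>M M) \<longrightarrow>
       (\<exists>k \<in> M \<rightarrow>\<^sub>M prob_algebra M. \<forall>A \<in> sets (M \<Otimes>\<^sub>M M).
          emeasure \<nu> A = (\<integral>\<^sup>+x. (\<integral>\<^sup>+y. indicator A (x, y) \<partial>k x) \<partial>distr \<nu> M fst)))"

definition good_measurable_space :: "'a measure \<Rightarrow> bool" where
  "good_measurable_space M \<longleftrightarrow>
     measure_decomposition M \<and>
     (\<exists>A. countable A \<and> A \<subseteq> Pow (space M) \<and> sets M = sigma_sets (space M) A)"

section \<open>Dirichlet spaces\<close>

text \<open>The form \<open>E\<close> is only meaningful on its domain \<open>F\<close>. The two \<open>AE_cong\<close> axioms say that \<open>F\<close> is a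
  set of classes modulo null sets and that \<open>E\<close> is defined on these classes.\<close>

locale dirichlet_space = sigma_finite_measure M
  for M :: "'a measure" +
  fixes E :: "('a \<Rightarrow> real) \<Rightarrow> ('a \<Rightarrow> real) \<Rightarrow> real"
    and F :: "('a \<Rightarrow> real) set"
  assumes good: "good_measurable_space M"
    and dom_L2: "F \<subseteq> Lp M 2"
    and dom_AE_cong:
      "\<And>u v. u \<in> F \<Longrightarrow> v \<in> borel_measurable M \<Longrightarrow> (AE x in M. u x = v x) \<Longrightarrow> v \<in> F"
    and dom_zero: "(\<lambda>x. 0) \<in> F"
    and dom_linear: "\<And>u v a b. u \<in> F \<Longrightarrow> v \<in> F \<Longrightarrow> (\<lambda>x. a * u x + b * v x) \<in> F"
    and dom_dense: "\<And>f \<epsilon>. f \<in> Lp M 2 \<Longrightarrow> 0 < \<epsilon> \<Longrightarrow> \<exists>u\<in>F. Lp_norm M 2 (\<lambda>x. f x - u x) < \<epsilon>"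
    and form_AE_cong:
      "\<And>u v w. u \<in> F \<Longrightarrow> v \<in> F \<Longrightarrow> w \<in> F \<Longrightarrow> (AE x in M. u x = v x) \<Longrightarrow> E u w = E v w"
    and form_sym: "\<And>u v. u \<in> F \<Longrightarrow> v \<in> F \<Longrightarrow> E u v = E v u"
    and form_linear: "\<And>u v w a b. u \<in> F \<Longrightarrow> v \<in> F \<Longrightarrow> w \<in> F \<Longrightarrow>
      E (\<lambda>x. a * u x + b * v x) w = a * E u w + b * E v w"
    and form_nonneg: "\<And>u. u \<in> F \<Longrightarrow> 0 \<le> E u u"
    and form_closed:
      "\<And>u :: nat \<Rightarrow> 'a \<Rightarrow> real. (\<And>n. u n \<in> F) \<Longrightarrow>
        (\<And>\<epsilon>. 0 < \<epsilon> \<Longrightarrow> \<exists>N. \<forall>m\<ge>N. \<forall>n\<ge>N.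
           (let d = (\<lambda>x. u m x - u n x) in E d d + L2_inner M d d) < \<epsilon>) \<Longrightarrow>
        \<exists>v\<in>F. (\<lambda>n. let d = (\<lambda>x. u n x - v x) in E d d + L2_inner M d d) \<longlonglongrightarrow> 0"
    and markovian:
      "\<And>u v. u \<in> F \<Longrightarrow> v \<in> borel_measurable M \<Longrightarrow>
        (AE (x, y) in M \<Otimes>\<^sub>M M. \<bar>v x - v y\<bar> \<le> \<bar>u x - u y\<bar>) \<Longrightarrow>
        (AE x in M. \<bar>v x\<bar> \<le> \<bar>u x\<bar>) \<Longrightarrow> v \<in> F \<and> E v v \<le> E u u"

section \<open>The heat semigroup\<close>

text \<open>\<open>P\<close> restricted to \<open>L\<^sup>2\<close> is the strongly continuous self-adjoint sub-Markovian semigroup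
  associated with \<open>(E, F)\<close>: its infinitesimal generator is the operator \<open>L\<close> of the form, for which
  \<open>L u = w\<close> iff \<open>u \<in> F\<close> and \<open>E u v = - \<langle>w, v\<rangle>\<close> for all \<open>v \<in> F\<close>. The same \<open>P\<close> acts as a contraction
  semigroup on every \<open>L\<^sup>p\<close>, \<open>1 \<le> p \<le> \<infinity>\<close>. For \<open>p < \<infinity>\<close> density of \<open>L\<^sup>2 \<inter> L\<^sup>p\<close> determines
  the extension; on \<open>L\<^sup>\<infinity>\<close> it is the adjoint of the semigroup on \<open>L\<^sup>1\<close>.\<close>

locale heat_semigroup =
  fixes M :: "'a measure"
    and E :: "('a \<Rightarrow> real) \<Rightarrow> ('a \<Rightarrow> real) \<Rightarrow> real"
    and F :: "('a \<Rightarrow> real) set"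
    and P :: "real \<Rightarrow> ('a \<Rightarrow> real) \<Rightarrow> 'a \<Rightarrow> real"
  assumes Lp_measurable:
      "\<And>p t f. 1 \<le> p \<Longrightarrow> 0 \<le> t \<Longrightarrow> f \<in> Lp M p \<Longrightarrow> P t f \<in> borel_measurable M"
    and Lp_contraction:
      "\<And>p t f. 1 \<le> p \<Longrightarrow> 0 \<le> t \<Longrightarrow> f \<in> Lp M p \<Longrightarrow> Lp_norm M p (P t f) \<le> Lp_norm M p f"
    and Lp_AE_cong:
      "\<And>p t f g. 1 \<le> p \<Longrightarrow> 0 \<le> t \<Longrightarrow> f \<in> Lp M p \<Longrightarrow> g \<in> Lp M p \<Longrightarrow>
        (AE x in M. f x = g x) \<Longrightarrow> (AE x in M. P t f x = P t g x)"
    and Lp_linear: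
      "\<And>p t f g a b. 1 \<le> p \<Longrightarrow> 0 \<le> t \<Longrightarrow> f \<in> Lp M p \<Longrightarrow> g \<in> Lp M p \<Longrightarrow>
        (AE x in M. P t (\<lambda>x. a * f x + b * g x) x = a * P t f x + b * P t g x)"
    and Lp_zero:
      "\<And>p f. 1 \<le> p \<Longrightarrow> f \<in> Lp M p \<Longrightarrow> (AE x in M. P 0 f x = f x)"
    and Lp_semigroup:
      "\<And>p s t f. 1 \<le> p \<Longrightarrow> 0 \<le> s \<Longrightarrow> 0 \<le> t \<Longrightarrow> f \<in> Lp M p \<Longrightarrow>
        (AE x in M. P (s + t) f x = P s (P t f) x)"
    and L2_strongly_continuous:
      "\<And>f. f \<in> Lp M 2 \<Longrightarrow> ((\<lambda>t. Lp_norm M 2 (\<lambda>x. P t f x - f x)) \<longlongrightarrow> 0) (at_right 0)"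
    and L2_self_adjoint:
      "\<And>t f g. 0 \<le> t \<Longrightarrow> f \<in> Lp M 2 \<Longrightarrow> g \<in> Lp M 2 \<Longrightarrow>
        L2_inner M (P t f) g = L2_inner M f (P t g)"
    and sub_markovian:
      "\<And>t f. 0 \<le> t \<Longrightarrow> f \<in> Lp M 2 \<Longrightarrow> (AE x in M. 0 \<le> f x \<and> f x \<le> 1) \<Longrightarrow>
        (AE x in M. 0 \<le> P t f x \<and> P t f x \<le> 1)"
    and generator:
      "\<And>u w. u \<in> Lp M 2 \<Longrightarrow> w \<in> Lp M 2 \<Longrightarrow>
        ((\<lambda>t. Lp_norm M 2 (\<lambda>x. (P t u x - u x) / t - w x)) \<longlongrightarrow> 0) (at_right 0) \<longleftrightarrow>
        u \<in> F \<and> (\<forall>v\<in>F. E u v = - L2_inner M w v)"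
    and Linf_dual:
      "\<And>t f g. 0 \<le> t \<Longrightarrow> f \<in> Lp M \<infinity> \<Longrightarrow> g \<in> Lp M 1 \<Longrightarrow>
        (\<integral>x. P t f x * g x \<partial>M) = (\<integral>x. f x * P t g x \<partial>M)"

definition conservative :: "'a measure \<Rightarrow> (real \<Rightarrow> ('a \<Rightarrow> real) \<Rightarrow> 'a \<Rightarrow> real) \<Rightarrow> bool" where
  "conservative M P \<longleftrightarrow> (\<forall>t\<ge>0. AE x in M. P t (\<lambda>_. 1) x = 1)"

definition heat_kernel ::
    "'a measure \<Rightarrow> (real \<Rightarrow> ('a \<Rightarrow> real) \<Rightarrow> 'a \<Rightarrow> real) \<Rightarrow> (real \<Rightarrow> 'a \<Rightarrow> 'a \<Rightarrow> real) \<Rightarrow> bool" where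
  "heat_kernel M P h \<longleftrightarrow>
     (\<lambda>(t, x, y). h t x y) \<in> borel_measurable (restrict_space borel {0<..} \<Otimes>\<^sub>M (M \<Otimes>\<^sub>M M)) \<and>
     (\<forall>t>0. \<forall>x\<in>space M. \<forall>y\<in>space M. 0 \<le> h t x y) \<and>
     (\<forall>t>0. \<forall>p\<ge>1. \<forall>f\<in>Lp M p. AE x in M.
        integrable M (\<lambda>y. h t x y * f y) \<and> P t f x = (\<integral>y. h t x y * f y \<partial>M))"

section \<open>Heat semigroup based Besov spaces\<close>

text \<open>The inner integral is \<open>P\<^sub>t(\<bar>f - f(y)\<bar>\<^sup>p)(y)\<close>, written with the heat kernel \<open>h\<close>.\<close>

definition besov_seminorm ::
    "'a measure \<Rightarrow> (real \<Rightarrow> 'a \<Rightarrow> 'a \<Rightarrow> real) \<Rightarrow> real \<Rightarrow> real \<Rightarrow> ('a \<Rightarrow> real) \<Rightarrow> ennreal" where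
  "besov_seminorm M h p \<alpha> f =
     (SUP t\<in>{0<..}. ennreal (t powr - \<alpha>) *
        epowr (\<integral>\<^sup>+y. (\<integral>\<^sup>+x. ennreal (\<bar>f x - f y\<bar> powr p * h t x y) \<partial>M) \<partial>M) (1 / p))"

definition besov_space ::
    "'a measure \<Rightarrow> (real \<Rightarrow> 'a \<Rightarrow> 'a \<Rightarrow> real) \<Rightarrow> real \<Rightarrow> real \<Rightarrow> ('a \<Rightarrow> real) set" where
  "besov_space M h p \<alpha> = {f \<in> Lp M (ennreal p). besov_seminorm M h p \<alpha> f < \<infinity>}"

end

theory Submission
  imports Defs
begin

text \<open>Write \<open>m(s) = \<mu>(\<bar>f\<bar> \<ge> s)\<close>, \<open>N\<close> for the Besov seminorm of \<open>f\<close> and \<open>\<theta> = p \<alpha> / \<beta> < 1\<close>.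
  On \<open>{\<bar>f(x)\<bar> \<ge> 2 s} \<times> {\<bar>f(y)\<bar> < s}\<close> one has \<open>\<bar>f(x) - f(y)\<bar> \<ge> s\<close>, while conservativeness and the kernel
  bound give \<open>P\<^sub>t 1\<^bsub>{\<bar>f\<bar> < s}\<^esub> \<ge> 1 - C t\<^bsup>-\<beta>\<^esup> m(s)\<close>. Choosing \<open>t\<close> with \<open>C t\<^bsup>-\<beta>\<^esup> m(s) = 1 / 2\<close> yields
  \<open>s\<^sup>p m(2 s) \<le> 2 (2 C m(s))\<^sup>\<theta> N\<^sup>p\<close>, that is \<open>w(2 s) \<le> B w(s)\<^sup>\<theta>\<close> for \<open>w(s) = s\<^sup>q m(s)\<close> and \<open>B\<close> a multiple of
  \<open>N\<^sup>p\<close>. As \<open>f \<in> L\<^sup>p\<close> makes \<open>w\<close> bounded on bounded intervals, the supremum absorbs itself and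
  \<open>w \<le> B\<^bsup>1 / (1 - \<theta>)\<^esup>\<close>.\<close>

section \<open>Superlevel sets: energy of one Markov kernel, doubling and Chebyshev bounds\<close>

lemma epowr_ennreal: "0 \<le> a \<Longrightarrow> epowr (ennreal a) r = ennreal (a powr r)"
  by (simp add: epowr_def)

text \<open>Fix \<open>x\<close> with \<bar>f x\<bar> \<ge> 2 s. Of the unit mass of
  \<open>k x\<close>, at most 1/2 sits where \<bar>f\<bar> \<ge> s, by the bound \<open>c\<close>;
  elsewhere the increment of \<open>f\<close> is at least \<open>s\<close>. So at least half of
  \<open>s powr p\<close> survives as energy, whence the factor 2.\<close>

lemma (in sigma_finite_measure) superlevel_energy_bound:
  fixes k :: "'a \<Rightarrow> 'a \<Rightarrow> real"
  assumes f[measurable]: "f \<in> borel_measurable M"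
    and k[measurable]: "case_prod k \<in> borel_measurable (M \<Otimes>\<^sub>M M)"
    and nonneg: "\<And>x y. x \<in> space M \<Longrightarrow> y \<in> space M \<Longrightarrow> 0 \<le> k x y"
    and total: "AE x in M. (\<integral>\<^sup>+y. ennreal (k x y) \<partial>M) = 1"
    and le: "AE (x, y) in M \<Otimes>\<^sub>M M. k x y \<le> c"
    and "0 \<le> c" "0 \<le> p" "0 < s"
    and fin: "emeasure M {x \<in> space M. s \<le> \<bar>f x\<bar>} < \<infinity>"
    and small: "c * measure M {x \<in> space M. s \<le> \<bar>f x\<bar>} \<le> 1 / 2"
  shows "ennreal (s powr p) * emeasure M {x \<in> space M. 2 * s \<le> \<bar>f x\<bar>}
    \<le> 2 * (\<integral>\<^sup>+y. (\<integral>\<^sup>+x. ennreal (\<bar>f x - f y\<bar> powr p * k x y) \<partial>M) \<partial>M)"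
proof -
  interpret pair_sigma_finite M M ..
  define D where "D = {x \<in> space M. s \<le> \<bar>f x\<bar>}"
  define J where "J x = (\<integral>\<^sup>+y. ennreal (\<bar>f x - f y\<bar> powr p * k x y) \<partial>M)" for x
  have [measurable]: "D \<in> sets M"
    unfolding D_def by measurable
  have [measurable]: "J \<in> borel_measurable M"
    unfolding J_def by measurable
  have J_ge: "ennreal (s powr p) * indicator {x \<in> space M. 2 * s \<le> \<bar>f x\<bar>} x \<le> 2 * J x"
    if x: "x \<in> space M" and tot: "(\<integral>\<^sup>+y. ennreal (k x y) \<partial>M) = 1"
      and ae: "AE y in M. k x y \<le> c" for x
  proof (cases "2 * s \<le> \<bar>f x\<bar>")
    case True
    have [measurable]: "(\<lambda>y. k x y) \<in> borel_measurable M"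
      using x by measurable
    have "ennreal (s powr p) = (\<integral>\<^sup>+y. ennreal (s powr p) * ennreal (k x y) \<partial>M)"
      using tot by (simp add: nn_integral_cmult)
    also have "\<dots> \<le> (\<integral>\<^sup>+y. ennreal (\<bar>f x - f y\<bar> powr p * k x y)
                        + ennreal (s powr p * c) * indicator D y \<partial>M)"
    proof (rule nn_integral_mono_AE, use ae in \<open>rule AE_mp\<close>, rule AE_I2, rule impI)
      fix y assume y: "y \<in> space M" and kc: "k x y \<le> c"
      show "ennreal (s powr p) * ennreal (k x y) \<le> ennreal (\<bar>f x - f y\<bar> powr p * k x y)
        + ennreal (s powr p * c) * indicator D y"
      proof (cases "y \<in> D")
        case True
        have "ennreal (s powr p) * ennreal (k x y) \<le> ennreal (s powr p * c)"
          using nonneg[OF x y] kc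
          by (simp add: ennreal_mult[symmetric] ennreal_leI mult_left_mono)
        then show ?thesis using True
          by (simp add: add_increasing)
      next
        case False
        then have "s \<le> \<bar>f x - f y\<bar>"
          using y \<open>2 * s \<le> \<bar>f x\<bar>\<close> by (auto simp: D_def)
        then have "s powr p * k x y \<le> \<bar>f x - f y\<bar> powr p * k x y"
          using \<open>0 < s\<close> \<open>0 \<le> p\<close> nonneg[OF x y]
          by (intro mult_right_mono powr_mono2) auto
        then show ?thesis using False nonneg[OF x y]
          by (simp add: ennreal_mult[symmetric] ennreal_leI)
      qed
    qed
    also have "\<dots> = J x + ennreal (s powr p * c) * emeasure M D"
      by (simp add: J_def nn_integral_add nn_integral_cmult_indicator)
    also have "emeasure M D = ennreal (measure M D)"
      using fin by (intro emeasure_eq_ennreal_measure) (auto simp: D_def)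
    also have "ennreal (s powr p * c) * ennreal (measure M D) \<le> ennreal (s powr p / 2)"
      using mult_left_mono[OF small, of "s powr p"] \<open>0 \<le> c\<close>
      by (auto simp: D_def ennreal_mult[symmetric] mult.assoc intro!: ennreal_leI)
    finally have *: "ennreal (s powr p) \<le> J x + ennreal (s powr p / 2)"
      by (simp add: add_left_mono)
    \<comment> \<open>Cancelling \<open>s powr p / 2\<close> takes place in the reals, so
      \<open>J x\<close> must be finite; an infinite \<open>J x\<close> makes the claim
      trivial.\<close>
    show ?thesis
    proof (cases "J x")
      case (real r)
      have "s powr p \<le> r + s powr p / 2"
        using * real by (simp add: ennreal_plus[symmetric] del: ennreal_plus)
      then have "ennreal (s powr p) \<le> ennreal (2 * r)"
        by (intro ennreal_leI) simp
      then show ?thesis using True x real by (simp add: ennreal_mult)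
    next
      case top
      then show ?thesis by (simp add: ennreal_mult_top)
    qed
  qed simp
  have "AE x in M. AE y in M. k x y \<le> c"
    using AE_pair[OF le] by simp
  with total AE_space
  have "AE x in M. ennreal (s powr p) * indicator {x \<in> space M. 2 * s \<le> \<bar>f x\<bar>} x \<le> 2 * J x"
    by eventually_elim (rule J_ge)
  then have "(\<integral>\<^sup>+x. ennreal (s powr p) * indicator {x \<in> space M. 2 * s \<le> \<bar>f x\<bar>} x \<partial>M)
      \<le> (\<integral>\<^sup>+x. 2 * J x \<partial>M)"
    by (rule nn_integral_mono_AE)
  also have "\<dots> = 2 * (\<integral>\<^sup>+x. J x \<partial>M)"
    by (simp add: nn_integral_cmult)
  \<comment> \<open>\<open>J\<close> integrates over \<open>y\<close> first, the energy over
    \<open>x\<close> first.\<close>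
  also have "(\<integral>\<^sup>+x. J x \<partial>M) = (\<integral>\<^sup>+y. (\<integral>\<^sup>+x. ennreal (\<bar>f x - f y\<bar> powr p * k x y) \<partial>M) \<partial>M)"
    unfolding J_def by (rule Fubini'[symmetric]) measurable
  finally show ?thesis
    by (simp add: nn_integral_cmult_indicator)
qed

text \<open>Boundedness near the origin is what makes the supremum over \<open>{0<..s}\<close> finite, so that it
  can be absorbed.\<close>

lemma doubling_power_bound:
  fixes w :: "real \<Rightarrow> real"
  assumes nonneg: "\<And>s. 0 < s \<Longrightarrow> 0 \<le> w s"
    and bdd: "\<And>S. 0 < S \<Longrightarrow> bdd_above (w ` {0<..S})"
    and double: "\<And>s. 0 < s \<Longrightarrow> w (2 * s) \<le> B * w s powr \<theta>"
    and "0 \<le> B" "0 \<le> \<theta>" "\<theta> < 1" "0 < s"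
  shows "w s \<le> B powr (1 / (1 - \<theta>))"
proof -
  define W where "W = (SUP r\<in>{0<..s}. w r)"
  have le_W: "w r \<le> W" if "0 < r" "r \<le> s" for r
    unfolding W_def using that bdd[OF \<open>0 < s\<close>] by (intro cSUP_upper) auto
  \<comment> \<open>Halving \<open>r\<close> stays inside \<open>{0<..s}\<close>, so doubling bounds
    every value by the supremum \<open>W\<close> itself.\<close>
  have "w r \<le> B * W powr \<theta>" if "0 < r" "r \<le> s" for r
  proof -
    have "w r \<le> B * w (r / 2) powr \<theta>"
      using double[of "r / 2"] that by simp
    also have "\<dots> \<le> B * W powr \<theta>"
      using that le_W[of "r / 2"] nonneg[of "r / 2"] \<open>0 \<le> B\<close> \<open>0 \<le> \<theta>\<close>
      by (intro mult_left_mono powr_mono2) auto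
    finally show ?thesis .
  qed
  then have W: "W \<le> B * W powr \<theta>"
    unfolding W_def using \<open>0 < s\<close> by (intro cSUP_least) auto
  have "W \<le> B powr (1 / (1 - \<theta>))"
  \<comment> \<open>Absorption divides by \<open>W powr \<theta>\<close>; if \<open>W\<close> is not
    positive, the nonnegative right-hand side dominates it.\<close>
  proof (cases "0 < W")
    case True
    have "W powr (1 - \<theta>) = W / W powr \<theta>"
      using True by (simp add: powr_diff)
    also have "\<dots> \<le> B"
      using W True by (simp add: divide_le_eq)
    finally have "(W powr (1 - \<theta>)) powr (1 / (1 - \<theta>)) \<le> B powr (1 / (1 - \<theta>))"
      using \<open>\<theta> < 1\<close> by (intro powr_mono2) auto
    then show ?thesis
      using True \<open>\<theta> < 1\<close> by (simp add: powr_powr)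
  next
    case False
    then show ?thesis by (meson not_less order_trans powr_ge_zero)
  qed
  with le_W[of s] \<open>0 < s\<close> show ?thesis by simp
qed

text \<open>Used only qualitatively: it makes superlevel sets finite and \<open>w\<close> bounded
  near the origin. The value of \<open>a\<close> depends on \<open>f\<close> but never enters the
  final constant.\<close>

lemma chebyshev_Lp:
  assumes "f \<in> Lp M (ennreal p)" and "1 \<le> p"
  obtains a where "0 \<le> a"
    and "\<And>s. 0 < s \<Longrightarrow> emeasure M {x \<in> space M. s \<le> \<bar>f x\<bar>} < \<infinity>"
    and "\<And>s. 0 < s \<Longrightarrow> s powr p * measure M {x \<in> space M. s \<le> \<bar>f x\<bar>} \<le> a"
proof
  define A where "A = (\<integral>\<^sup>+x. ennreal (\<bar>f x\<bar> powr p) \<partial>M)"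
  have [measurable]: "f \<in> borel_measurable M"
    using assms by (simp add: Lp_def)
  \<comment> \<open>An infinite integral would make the norm infinite, since \<open>epowr\<close>
    fixes infinity.\<close>
  have "A < \<infinity>"
    using assms by (cases "A = \<infinity>") (auto simp: Lp_def Lp_norm_def epowr_def A_def less_top)
  then show "0 \<le> enn2real A" by simp
  fix s :: real assume s: "0 < s"
  have "ennreal (s powr p) * emeasure M {x \<in> space M. s \<le> \<bar>f x\<bar>}
      = (\<integral>\<^sup>+x. ennreal (s powr p) * indicator {x \<in> space M. s \<le> \<bar>f x\<bar>} x \<partial>M)"
    by (simp add: nn_integral_cmult_indicator)
  also have "\<dots> \<le> A"
    unfolding A_def using s \<open>1 \<le> p\<close>
    by (intro nn_integral_mono) (auto simp: indicator_def intro!: ennreal_leI powr_mono2)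
  finally have le: "ennreal (s powr p) * emeasure M {x \<in> space M. s \<le> \<bar>f x\<bar>} \<le> A" .
  then show fin: "emeasure M {x \<in> space M. s \<le> \<bar>f x\<bar>} < \<infinity>"
    using \<open>A < \<infinity>\<close> s by (cases "emeasure M {x \<in> space M. s \<le> \<bar>f x\<bar>}")
      (auto simp: ennreal_mult_top top_unique)
  have "ennreal (s powr p * measure M {x \<in> space M. s \<le> \<bar>f x\<bar>}) \<le> ennreal (enn2real A)"
    using le fin \<open>A < \<infinity>\<close> by (simp add: ennreal_mult emeasure_eq_ennreal_measure)
  then show "s powr p * measure M {x \<in> space M. s \<le> \<bar>f x\<bar>} \<le> enn2real A"
    by (simp add: ennreal_le_iff)
qed

section \<open>The heat kernel at a fixed time and its Besov energy\<close>

lemma heat_kernel_measurable: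
  assumes "heat_kernel M P h" and "0 < t"
  shows "case_prod (h t) \<in> borel_measurable (M \<Otimes>\<^sub>M M)"
proof -
  have "(\<lambda>z. (t, z)) \<in> M \<Otimes>\<^sub>M M \<rightarrow>\<^sub>M restrict_space borel {0<..} \<Otimes>\<^sub>M (M \<Otimes>\<^sub>M M)"
    using \<open>0 < t\<close> by (intro measurable_Pair measurable_const measurable_ident)
      (simp_all add: space_restrict_space)
  moreover have "(\<lambda>(t, x, y). h t x y)
      \<in> borel_measurable (restrict_space borel {0<..} \<Otimes>\<^sub>M (M \<Otimes>\<^sub>M M))"
    using assms by (simp add: heat_kernel_def)
  ultimately have "(\<lambda>z. (\<lambda>(t, x, y). h t x y) (t, z)) \<in> borel_measurable (M \<Otimes>\<^sub>M M)"
    by (rule measurable_compose)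
  then show ?thesis by (simp add: case_prod_beta')
qed

text \<open>The kernel also represents the semigroup at exponent \<infinity>. This is the case to
  use, because the constant 1 may lie in no \<open>Lp\<close> with finite exponent when the space
  has infinite measure.\<close>

lemma heat_kernel_total:
  assumes "heat_kernel M P h" and "conservative M P" and "0 < t"
  shows "AE x in M. (\<integral>\<^sup>+y. ennreal (h t x y) \<partial>M) = 1"
proof -
  have one: "(\<lambda>_. 1) \<in> Lp M \<infinity>"
  proof -
    have "esssup M (\<lambda>_. 1 :: ennreal) \<le> 1"
      by (rule esssup_I) auto
    also have "1 < (\<infinity> :: ennreal)" by simp
    finally show ?thesis by (simp add: Lp_def Lp_norm_def)
  qed
  have "\<forall>p\<ge>1. \<forall>f\<in>Lp M p. AE x in M.
      integrable M (\<lambda>y. h t x y * f y) \<and> P t f x = (\<integral>y. h t x y * f y \<partial>M)"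
    using assms by (simp add: heat_kernel_def)
  from this[rule_format, OF _ one]
  have "AE x in M. integrable M (\<lambda>y. h t x y * 1) \<and> P t (\<lambda>_. 1) x = (\<integral>y. h t x y * 1 \<partial>M)"
    by simp
  moreover have "AE x in M. P t (\<lambda>_. 1) x = 1"
    using assms by (simp add: conservative_def)
  ultimately show ?thesis
    using AE_space
  proof eventually_elim
    case (elim x)
    then have "(\<integral>\<^sup>+y. ennreal (h t x y) \<partial>M) = ennreal (\<integral>y. h t x y \<partial>M)"
      using assms by (intro nn_integral_eq_integral AE_I2) (auto simp: heat_kernel_def)
    with elim show ?case by simp
  qed
qed

text \<open>One time \<open>t\<close> of the supremum suffices: clear the factor
  \<open>t powr - \<alpha>\<close> and raise to the power \<open>p\<close>. Infinite energy is
  excluded since that factor is positive.\<close>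

lemma energy_le_besov_seminorm:
  assumes "besov_seminorm M h p \<alpha> f \<le> ennreal n" and "0 \<le> n" and "0 < p" and "0 < t"
  shows "(\<integral>\<^sup>+y. (\<integral>\<^sup>+x. ennreal (\<bar>f x - f y\<bar> powr p * h t x y) \<partial>M) \<partial>M)
    \<le> ennreal (t powr (\<alpha> * p) * n powr p)" (is "?I \<le> _")
proof -
  have "ennreal (t powr - \<alpha>) * epowr ?I (1 / p) \<le> besov_seminorm M h p \<alpha> f"
    unfolding besov_seminorm_def using \<open>0 < t\<close> by (intro SUP_upper) auto
  also note assms(1)
  finally have le: "ennreal (t powr - \<alpha>) * epowr ?I (1 / p) \<le> ennreal n" .
  show ?thesis
  proof (cases ?I)
    case (real r)
    then have "t powr - \<alpha> * r powr (1 / p) \<le> n"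
      using le \<open>0 \<le> n\<close> by (simp add: epowr_ennreal ennreal_mult[symmetric])
    then have "r powr (1 / p) \<le> t powr \<alpha> * n"
      using \<open>0 < t\<close> by (simp add: powr_minus field_simps)
    then have "(r powr (1 / p)) powr p \<le> (t powr \<alpha> * n) powr p"
      using \<open>0 < p\<close> by (intro powr_mono2) auto
    then have "r \<le> t powr (\<alpha> * p) * n powr p"
      using real \<open>0 < p\<close> \<open>0 \<le> n\<close> by (simp add: powr_powr powr_mult)
    then show ?thesis
      using real by (simp add: ennreal_leI)
  next
    case top
    then show ?thesis
      using le \<open>0 < t\<close> by (simp add: epowr_def ennreal_mult_top top_unique)
  qed
qed

section \<open>The weak-type inequality\<close>

theorem theorem6p3:
  fixes M :: "'a measure"
    and E :: "('a \<Rightarrow> real) \<Rightarrow> ('a \<Rightarrow> real) \<Rightarrow> real"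
    and F :: "('a \<Rightarrow> real) set"
    and P :: "real \<Rightarrow> ('a \<Rightarrow> real) \<Rightarrow> 'a \<Rightarrow> real"
    and h :: "real \<Rightarrow> 'a \<Rightarrow> 'a \<Rightarrow> real"
    and C \<alpha> \<beta> p q :: real
  assumes "dirichlet_space M E F"
    and "heat_semigroup M E F P"
    and "conservative M P"
    and "heat_kernel M P h"
    and "C > 0" and "\<beta> > 0"
    and "\<And>t. t > 0 \<Longrightarrow> AE (x, y) in M \<Otimes>\<^sub>M M. h t x y \<le> C * t powr - \<beta>"
    and "0 < \<alpha>" and "\<alpha> < \<beta>"
    and "1 \<le> p" and "p < \<beta> / \<alpha>"
    and "q = p * \<beta> / (\<beta> - p * \<alpha>)"
  shows "\<exists>K::real. K > 0 \<and> (\<forall>f \<in> besov_space M h p \<alpha>.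
           (SUP s\<in>{0::real..}. ennreal s * epowr (emeasure M {x \<in> space M. \<bar>f x\<bar> \<ge> s}) (1 / q))
             \<le> ennreal K * besov_seminorm M h p \<alpha> f)"
proof -
  interpret dirichlet_space M E F by fact
  define \<theta> where "\<theta> = \<alpha> * p / \<beta>"
  have "p * \<alpha> < \<beta>"
    using \<open>p < \<beta> / \<alpha>\<close> \<open>0 < \<alpha>\<close> by (simp add: pos_less_divide_eq)
  then have \<theta>: "0 < \<theta>" "\<theta> < 1"
    using assms by (simp_all add: \<theta>_def field_simps)
  \<comment> \<open>This identity is what fixes \<open>q\<close>: it makes the doubling inequality
    scale-invariant and the final bound linear in the seminorm.\<close>
  have q: "q * (1 - \<theta>) = p"
    using assms \<open>p * \<alpha> < \<beta>\<close> by (simp add: \<theta>_def field_simps)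
  have "0 < q"
    using assms \<open>p * \<alpha> < \<beta>\<close> by simp
  have "p \<le> q"
    using mult_left_le[of "1 - \<theta>" q] q \<theta> \<open>0 < q\<close> by simp
  \<comment> \<open>The factor \<open>2 powr q\<close> comes from evaluating \<open>w\<close> at
    \<open>2 * r\<close>, the rest from the energy estimate \<open>step\<close>.\<close>
  define A where "A = 2 powr q * (2 * (2 * C) powr \<theta>)"
  define K where "K = A powr (1 / p)"
  have "0 < A"
    using \<open>C > 0\<close> by (simp add: A_def)
  \<comment> \<open>Finiteness is carried along because \<open>measure\<close> is 0 on sets of
    infinite measure, so the real inequality alone says nothing about
    \<open>emeasure\<close>.\<close>
  have "s * measure M {x \<in> space M. s \<le> \<bar>f x\<bar>} powr (1 / q) \<le> K * n
      \<and> emeasure M {x \<in> space M. s \<le> \<bar>f x\<bar>} < \<infinity>"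
    if f: "f \<in> Lp M (ennreal p)" and n: "besov_seminorm M h p \<alpha> f \<le> ennreal n" "0 \<le> n"
      and "0 < s" for f n s
  proof -
    define m where "m r = measure M {x \<in> space M. r \<le> \<bar>f x\<bar>}" for r
    obtain a where a: "0 \<le> a"
      and fin: "\<And>s. 0 < s \<Longrightarrow> emeasure M {x \<in> space M. s \<le> \<bar>f x\<bar>} < \<infinity>"
      and "\<And>s. 0 < s \<Longrightarrow> s powr p * measure M {x \<in> space M. s \<le> \<bar>f x\<bar>} \<le> a"
      by (rule chebyshev_Lp[OF f \<open>1 \<le> p\<close>]) (rule that)
    then have cheb: "r powr p * m r \<le> a" if "0 < r" for r
      using that by (simp add: m_def)
    have meas[measurable]: "f \<in> borel_measurable M"
      using f by (simp add: Lp_def)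
    have m_nonneg: "0 \<le> m r" for r
      by (simp add: m_def)
    have step: "r powr p * m (2 * r) \<le> 2 * (2 * C * m r) powr \<theta> * n powr p" if "0 < r" for r
    proof (cases "m r = 0")
      \<comment> \<open>Here the time chosen below would be 0; instead both sides vanish by
        monotonicity of \<open>m\<close>.\<close>
      case True
      have "m (2 * r) \<le> m r"
        unfolding m_def using fin[OF that] that
        by (intro measure_mono_fmeasurable) (auto simp: fmeasurable_def)
      then show ?thesis
        using True m_nonneg[of "2 * r"] by simp
    next
      case False
      then have "0 < m r"
        using m_nonneg[of r] by simp
      \<comment> \<open>the time at which the kernel bound gives the superlevel set mass at most \<open>1 / 2\<close>\<close>
      define t where "t = (2 * C * m r) powr (1 / \<beta>)"
      have "0 < t"
        using \<open>0 < m r\<close> \<open>C > 0\<close> by (simp add: t_def)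
      have "t powr - \<beta> = 1 / (2 * C * m r)"
        using \<open>0 < m r\<close> \<open>C > 0\<close> \<open>\<beta> > 0\<close> by (simp add: t_def powr_powr powr_minus_divide)
      then have small: "C * t powr - \<beta> * m r \<le> 1 / 2"
        using \<open>0 < m r\<close> \<open>C > 0\<close> by simp
      have t: "t powr (\<alpha> * p) = (2 * C * m r) powr \<theta>"
        by (simp add: t_def \<theta>_def powr_powr)
      have "ennreal (r powr p * m (2 * r))
          = ennreal (r powr p) * emeasure M {x \<in> space M. 2 * r \<le> \<bar>f x\<bar>}"
        using fin[of "2 * r"] that by (simp add: m_def ennreal_mult emeasure_eq_ennreal_measure)
      also have "\<dots> \<le> 2 * (\<integral>\<^sup>+y. (\<integral>\<^sup>+x. ennreal (\<bar>f x - f y\<bar> powr p * h t x y) \<partial>M) \<partial>M)"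
        using assms(3-7) \<open>1 \<le> p\<close> \<open>0 < t\<close> \<open>0 < r\<close> small fin[of r]
        by (intro superlevel_energy_bound[where c = "C * t powr - \<beta>"] heat_kernel_measurable
            heat_kernel_total) (auto simp: heat_kernel_def m_def)
      also have "\<dots> \<le> 2 * ennreal (t powr (\<alpha> * p) * n powr p)"
        using \<open>1 \<le> p\<close> \<open>0 < t\<close> n by (intro mult_left_mono energy_le_besov_seminorm) auto
      also have "\<dots> = ennreal (2 * (2 * C * m r) powr \<theta> * n powr p)"
        unfolding t by (simp add: ennreal_mult mult.assoc)
      finally show ?thesis
        by (simp add: ennreal_le_iff)
    qed
    define w where "w r = r powr q * m r" for r
    have "w s \<le> (A * n powr p) powr (1 / (1 - \<theta>))"
    proof (rule doubling_power_bound[where w = w])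
      show "0 \<le> w r" for r
        by (simp add: w_def m_nonneg)
      show "bdd_above (w ` {0<..S})" if "0 < S" for S
      proof (rule bdd_aboveI2)
        fix r assume r: "r \<in> {0<..S}"
        \<comment> \<open>Since p \<le> q, the first factor is nondecreasing in \<open>r\<close>,
          and Chebyshev bounds the second.\<close>
        have "w r = r powr (q - p) * (r powr p * m r)"
          using r by (simp add: w_def powr_diff)
        also have "\<dots> \<le> S powr (q - p) * a"
          using r cheb[of r] \<open>p \<le> q\<close> m_nonneg by (intro mult_mono powr_mono2) auto
        finally show "w r \<le> S powr (q - p) * a" .
      qed
      show "w (2 * r) \<le> A * n powr p * w r powr \<theta>" if "0 < r" for r
      proof -
        \<comment> \<open>Splitting q = q \<theta> + p leaves \<open>r powr p\<close> for
          \<open>step\<close>, while \<open>r powr (q * \<theta>)\<close> joins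
          \<open>m r powr \<theta>\<close> to form \<open>w r powr \<theta>\<close>.\<close>
        have "w (2 * r) = 2 powr q * r powr (q * \<theta>) * (r powr p * m (2 * r))"
        proof -
          have "r powr (q * \<theta>) * r powr p = r powr q"
            unfolding powr_add[symmetric] using q by (simp add: algebra_simps)
          then show ?thesis
            using that by (simp add: w_def powr_mult)
        qed
        also have "\<dots> \<le> 2 powr q * r powr (q * \<theta>) * (2 * (2 * C * m r) powr \<theta> * n powr p)"
          using step[OF that] by (intro mult_left_mono) auto
        also have "\<dots> = A * n powr p * w r powr \<theta>"
          using that \<open>C > 0\<close> m_nonneg[of r] by (simp add: w_def A_def powr_mult powr_powr)
        finally show ?thesis .
      qed
    qed (use \<open>0 < A\<close> \<theta> \<open>0 < s\<close> in auto)
    then have "w s powr (1 / q) \<le> ((A * n powr p) powr (1 / (1 - \<theta>))) powr (1 / q)"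
      using \<open>0 < q\<close> m_nonneg by (intro powr_mono2) (auto simp: w_def)
    also have "\<dots> = (A * n powr p) powr (1 / p)"
      by (simp add: powr_powr q[symmetric] mult.commute)
    also have "\<dots> = K * n"
      using \<open>0 < A\<close> \<open>1 \<le> p\<close> n by (simp add: K_def powr_mult powr_powr)
    also have "w s powr (1 / q) = s * m s powr (1 / q)"
      using \<open>0 < s\<close> \<open>0 < q\<close> m_nonneg[of s] by (simp add: w_def powr_mult powr_powr)
    finally show ?thesis
      using fin[OF \<open>0 < s\<close>] by (simp add: m_def)
  qed
  note weak = this
  show ?thesis
  proof (intro exI conjI ballI SUP_least)
    show "0 < K"
      using \<open>0 < A\<close> by (simp add: K_def)
    fix f s assume f: "f \<in> besov_space M h p \<alpha>" and s: "s \<in> {0::real..}"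
    from f have fL: "f \<in> Lp M (ennreal p)" and "besov_seminorm M h p \<alpha> f < \<infinity>"
      by (auto simp: besov_space_def)
    then obtain n where n: "besov_seminorm M h p \<alpha> f = ennreal n" "0 \<le> n"
      by (cases "besov_seminorm M h p \<alpha> f") auto
    show "ennreal s * epowr (emeasure M {x \<in> space M. s \<le> \<bar>f x\<bar>}) (1 / q)
        \<le> ennreal K * besov_seminorm M h p \<alpha> f"
    \<comment> \<open>At \<open>s = 0\<close> the superlevel set is the whole space, possibly of
      infinite measure; the product is still 0 in \<open>ennreal\<close>.\<close>
    proof (cases "s = 0")
      case False
      with s have "0 < s" by simp
      from weak[OF fL _ n(2) this] n(1)
      have le: "s * measure M {x \<in> space M. s \<le> \<bar>f x\<bar>} powr (1 / q) \<le> K * n"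
        and fin: "emeasure M {x \<in> space M. s \<le> \<bar>f x\<bar>} < \<infinity>" by auto
      have "ennreal s * epowr (emeasure M {x \<in> space M. s \<le> \<bar>f x\<bar>}) (1 / q)
          = ennreal (s * measure M {x \<in> space M. s \<le> \<bar>f x\<bar>} powr (1 / q))"
        using fin \<open>0 < s\<close> by (simp add: emeasure_eq_ennreal_measure epowr_ennreal ennreal_mult)
      also have "\<dots> \<le> ennreal (K * n)"
        using le by (rule ennreal_leI)
      finally show ?thesis
        using n \<open>0 < K\<close> by (simp add: ennreal_mult)
    qed simp
  qed
qed

end
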